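(* Let $\kappa$ be a signature wavelet and let $\sigma$ denote the signature with respect to $\kappa$. Let $f\in\mathscr{S}'(\mathbb{R})/\mathscr{P}$, $b\in\mathbb{R}$ and $\alpha\in\mathbb{R}$. Then $$\sigma(\mathcal{H}^\alpha f)(b)=e^{i\alpha\frac{\pi}{2}}\,\sigma f(b).$$
   Context: The Fourier transform is $\widehat f(\omega)=\int_{\mathbb{R}}e^{-i\omega x}f(x)\,dx$, extended to tempered distributions as usual. A signature wavelet is a non-zero complex-valued Schwartz function $\kappa\in\mathscr{S}(\mathbb{R},\mathbb{C})$ such that $\operatorname{supp}\widehat\kappa\subseteq[c,d]$ for some $0<c<d<\infty$ and $\widehat\kappa(\omega)\ge 0$ for all $\omega\in\mathbb{R}$. For $a>0$, $b\in\mathbb{R}$ put $\kappa_{a,b}(x)=\frac{1}{\sqrt a}\,\kappa\left(\frac{x-b}{a}\right)$. The pairing $\langle f,\phi\rangle$ of a tempered distribution with a Schwartz function is bilinear (no complex conjugation), i.e. $\langle f,\phi\rangle=\int f\phi\,dx$ for functions $f$. For $z\in\mathbb{C}\setminus\{0\}$, $\operatorname{sgn} z=z/|z|$, and $\operatorname{sgn}0=0$. The signature of $f$ at $b$ (with respect to $\kappa$) is $\sigma f(b)=\lim_{a\to0+}\operatorname{sgn}\langle f,\kappa_{a,b}\rangle$ if this limit exists in $\mathbb{C}$, and $\sigma f(b)=0$ otherwise. $\mathscr{P}$ denotes the polynomials and $\mathscr{S}'(\mathbb{R})/\mathscr{P}$ the tempered distributions modulo polynomials; equivalently, the continuous linear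 functionals on the space of Schwartz functions all of whose moments vanish (i.e. whose Fourier transforms vanish to infinite order at $0$). Since $\langle p,\kappa_{a,b}\rangle=0$ for all polynomials $p$, the signature is well defined on $\mathscr{S}'(\mathbb{R})/\mathscr{P}$. For $\alpha\in\mathbb{R}$ the fractional Hilbert transform $\mathcal{H}^\alpha$ is defined on $\mathscr{S}'(\mathbb{R})/\mathscr{P}$ by $\widehat{\mathcal{H}^\alpha f}(\omega)=e^{-i\alpha\frac{\pi}{2}\operatorname{sgn}(\omega)}\,\widehat f(\omega)$. *)

theory Defs
  imports "HOL-Analysis.Analysis"
begin

section \<open>Schwartz functions\<close>

definition vderiv :: "nat \<Rightarrow> (real \<Rightarrow> complex) \<Rightarrow> real \<Rightarrow> complex" where
  "vderiv n = (\<lambda>g x. vector_derivative g (at x)) ^^ n"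

definition schwartz :: "(real \<Rightarrow> complex) set" where
  "schwartz = {\<phi>. (\<forall>n x. vderiv n \<phi> differentiable (at x)) \<and>
                  (\<forall>m n. bounded (range (\<lambda>x. of_real (x ^ m) * vderiv n \<phi> x)))}"

definition schwartz_norm :: "nat \<Rightarrow> (real \<Rightarrow> complex) \<Rightarrow> real" where
  "schwartz_norm N \<phi> = (\<Sum>m\<le>N. \<Sum>n\<le>N. SUP x. norm (of_real (x ^ m) * vderiv n \<phi> x))"

definition schwartz0 :: "(real \<Rightarrow> complex) set" where
  "schwartz0 = {\<phi> \<in> schwartz. \<forall>n. (LINT x|lborel. of_real (x ^ n) * \<phi> x) = 0}"

section \<open>Distributions\<close>

text \<open>
  Complex-linear functionals on a subspace \<open>X\<close> of the Schwartz space that are continuous for the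
  Schwartz topology.  Functionals are total functions in HOL; only their values on \<open>X\<close> matter.
\<close>

definition schwartz_dual :: "(real \<Rightarrow> complex) set \<Rightarrow> ((real \<Rightarrow> complex) \<Rightarrow> complex) set" where
  "schwartz_dual X = {u.
     (\<forall>\<phi>\<in>X. \<forall>\<psi>\<in>X. u (\<lambda>x. \<phi> x + \<psi> x) = u \<phi> + u \<psi>) \<and>
     (\<forall>c. \<forall>\<phi>\<in>X. u (\<lambda>x. c * \<phi> x) = c * u \<phi>) \<and>
     (\<exists>C N. \<forall>\<phi>\<in>X. norm (u \<phi>) \<le> C * schwartz_norm N \<phi>)}"

definition tempered :: "((real \<Rightarrow> complex) \<Rightarrow> complex) set" where
  "tempered = schwartz_dual schwartz"

text \<open>
  Tempered distributions modulo polynomials, as the dual of the space of Schwartz functions with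
  vanishing moments; the class of a tempered distribution is its restriction to that space.
\<close>

definition tempered_mod_poly :: "((real \<Rightarrow> complex) \<Rightarrow> complex) set" where
  "tempered_mod_poly = schwartz_dual schwartz0"

lemma tempered_imp_mod_poly: "u \<in> tempered \<Longrightarrow> u \<in> tempered_mod_poly"
  unfolding tempered_def tempered_mod_poly_def schwartz_dual_def schwartz0_def by blast

section \<open>Fourier transform and fractional Hilbert transform\<close>

definition fourier :: "(real \<Rightarrow> complex) \<Rightarrow> real \<Rightarrow> complex" where
  "fourier \<phi> \<omega> = (LINT x|lborel. exp (- \<i> * of_real (\<omega> * x)) * \<phi> x)"

definition inv_fourier :: "(real \<Rightarrow> complex) \<Rightarrow> real \<Rightarrow> complex" where
  "inv_fourier \<phi> x = (LINT \<omega>|lborel. exp (\<i> * of_real (\<omega> * x)) * \<phi> \<omega>) / of_real (2 * pi)"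

text \<open>
  The transforms of a functional on \<^const>\<open>schwartz0\<close> are functionals on the Schwartz functions
  vanishing to infinite order at 0, the image of \<^const>\<open>schwartz0\<close> under \<^const>\<open>fourier\<close>.  That
  space is stable under multiplication by the symbol of the fractional Hilbert transform, although
  the symbol jumps at 0.
\<close>

definition dist_fourier ::
  "((real \<Rightarrow> complex) \<Rightarrow> complex) \<Rightarrow> (real \<Rightarrow> complex) \<Rightarrow> complex" where
  "dist_fourier u = (\<lambda>\<phi>. u (fourier \<phi>))"

definition dist_inv_fourier ::
  "((real \<Rightarrow> complex) \<Rightarrow> complex) \<Rightarrow> (real \<Rightarrow> complex) \<Rightarrow> complex" where
  "dist_inv_fourier u = (\<lambda>\<phi>. u (inv_fourier \<phi>))"

definition dist_mult ::
  "(real \<Rightarrow> complex) \<Rightarrow> ((real \<Rightarrow> complex) \<Rightarrow> complex) \<Rightarrow> (real \<Rightarrow> complex) \<Rightarrow> complex" where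
  "dist_mult m u = (\<lambda>\<phi>. u (\<lambda>\<omega>. m \<omega> * \<phi> \<omega>))"

definition frac_hilbert ::
  "real \<Rightarrow> ((real \<Rightarrow> complex) \<Rightarrow> complex) \<Rightarrow> (real \<Rightarrow> complex) \<Rightarrow> complex" where
  "frac_hilbert \<alpha> f =
     dist_inv_fourier
       (dist_mult (\<lambda>\<omega>. exp (- \<i> * of_real (\<alpha> * (pi / 2) * sgn \<omega>))) (dist_fourier f))"

section \<open>Signature\<close>

definition signature_wavelet :: "(real \<Rightarrow> complex) \<Rightarrow> bool" where
  "signature_wavelet \<kappa> \<longleftrightarrow>
     \<kappa> \<in> schwartz \<and> \<kappa> \<noteq> (\<lambda>x. 0) \<and>
     (\<exists>c d. 0 < c \<and> c < d \<and> closure {\<omega>. fourier \<kappa> \<omega> \<noteq> 0} \<subseteq> {c..d}) \<and>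
     (\<forall>\<omega>. fourier \<kappa> \<omega> \<in> \<real>\<^sub>\<ge>\<^sub>0)"

definition wavelet :: "(real \<Rightarrow> complex) \<Rightarrow> real \<Rightarrow> real \<Rightarrow> real \<Rightarrow> complex" where
  "wavelet \<kappa> a b = (\<lambda>x. of_real (1 / sqrt a) * \<kappa> ((x - b) / a))"

definition signature ::
  "(real \<Rightarrow> complex) \<Rightarrow> ((real \<Rightarrow> complex) \<Rightarrow> complex) \<Rightarrow> real \<Rightarrow> complex" where
  "signature \<kappa> f b =
     (if \<exists>L. ((\<lambda>a. sgn (f (wavelet \<kappa> a b))) \<longlongrightarrow> L) (at_right 0)
      then Lim (at_right 0) (\<lambda>a. sgn (f (wavelet \<kappa> a b)))
      else 0)"

end

theory Submission
  imports Defs "HOL-Probability.Sinc_Integral" "HOL-Probability.Characteristic_Functions"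
begin

text \<open>
  Testing \<open>H\<^sup>\<alpha> f\<close> against a Schwartz function \<open>\<phi>\<close> means testing \<open>f\<close> against the function obtained
  from \<open>\<phi>\<close> by multiplying its inverse transform by \<open>exp (- i \<alpha> (\<pi>/2) sgn \<omega>)\<close> and transforming back.
  If the transform of \<open>\<phi>\<close> lives on positive frequencies, the inverse transform, being its
  reflection up to a constant, lives on negative frequencies.  There the symbol is the constant
  \<open>exp (i \<alpha> \<pi>/2)\<close>, and its jump at 0 is never seen.  Fourier inversion and linearity of \<open>f\<close> then give
  \<open>(H\<^sup>\<alpha> f) \<phi> = exp (i \<alpha> \<pi>/2) f \<phi>\<close> (\<open>frac_hilbert_positive_spectrum\<close>).

  Every wavelet \<open>\<kappa>\<^sub>a\<^sub>,\<^sub>b\<close> is such a \<open>\<phi>\<close>, because dilation by \<open>a > 0\<close> preserves positivity of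
  frequencies and translation only modulates the transform (\<open>fourier_wavelet\<close>).  So all wavelet
  coefficients, and hence their signs, are multiplied by one and the same unimodular number; this
  number passes through the limit defining the signature and through its convention for divergence
  (\<open>signature_unimodular_factor\<close>).

  Two analytic facts carry the argument.  Linearity of \<open>f\<close> is only given on functions with vanishing
  moments; the moments of \<open>\<phi>\<close> vanish because its transform is zero around 0 and the moments are, up
  to powers of \<open>i\<close>, derivatives of the transform there (\<open>schwartz0_if_fourier_vanishes_near_0\<close>).
  Fourier inversion (\<open>fourier_inv_fourier\<close>) is proved by Gaussian regularization.
\<close>

section \<open>Schwartz functions under affine substitution\<close>

lemma schwartz_vderiv_bound:
  assumes "\<phi> \<in> schwartz"
  obtains B where "\<And>x. norm (of_real (x ^ m) * vderiv n \<phi> x) \<le> B"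
proof -
  have "bounded (range (\<lambda>x. of_real (x ^ m) * vderiv n \<phi> x))"
    using assms by (auto simp: schwartz_def)
  then obtain B where "\<And>x. norm (of_real (x ^ m) * vderiv n \<phi> x) \<le> B"
    by (auto simp: bounded_pos)
  then show thesis using that[of B] by blast
qed

lemma schwartz_bound:
  assumes "\<phi> \<in> schwartz"
  obtains B where "\<And>x. norm (of_real (x ^ m) * \<phi> x) \<le> B"
  using schwartz_vderiv_bound[OF assms, of m 0] by (auto simp: vderiv_def)

lemma schwartz_continuous:
  assumes "\<phi> \<in> schwartz"
  shows "isCont \<phi> x"
proof -
  have "vderiv 0 \<phi> differentiable (at x)" using assms unfolding schwartz_def by blast
  then show ?thesis by (simp add: vderiv_def differentiable_imp_continuous_within)
qed

lemma schwartz_measurable: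
  assumes "\<phi> \<in> schwartz"
  shows "\<phi> \<in> borel_measurable borel"
  by (intro borel_measurable_continuous_onI continuous_at_imp_continuous_on ballI
      schwartz_continuous assms)

lemma vderiv_affine:
  assumes "\<phi> \<in> schwartz"
  shows "vderiv n (\<lambda>x. c * \<phi> (t + s * x)) = (\<lambda>x. c * of_real (s ^ n) * vderiv n \<phi> (t + s * x))"
proof (induction n)
  case 0
  then show ?case by (simp add: vderiv_def)
next
  case (Suc n)
  have step: "vderiv (Suc n) g = (\<lambda>x. vector_derivative (vderiv n g) (at x))" for g
    by (simp add: vderiv_def)
  show ?case
  proof
    fix x
    have d: "vderiv n \<phi> differentiable (at y)" for y
      using assms unfolding schwartz_def by blast
    have "((\<lambda>x. t + s * x) has_vector_derivative s) (at x)"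
      by (auto intro!: derivative_eq_intros)
    from vector_diff_chain_at[OF this, of "vderiv n \<phi>"] d[of "t + s * x"]
    have "((\<lambda>x. vderiv n \<phi> (t + s * x)) has_vector_derivative
        s *\<^sub>R vderiv (Suc n) \<phi> (t + s * x)) (at x)"
      by (simp add: vector_derivative_works step o_def)
    from has_vector_derivative_mult_right[OF this, of "c * of_real (s ^ n)"]
    show "vderiv (Suc n) (\<lambda>x. c * \<phi> (t + s * x)) x =
        c * of_real (s ^ Suc n) * vderiv (Suc n) \<phi> (t + s * x)"
      unfolding step[of "\<lambda>x. c * \<phi> (t + s * x)"] Suc.IH
      by (subst vector_derivative_at) (auto simp: scaleR_conv_of_real mult_ac)
  qed
qed

text \<open>
  The decay estimates of \<open>\<phi>\<close> are in powers of \<open>y = t + s x\<close>; they transfer because \<open>\<bar>x\<bar>\<close> is at most a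
  constant times \<open>max 1 \<bar>y\<bar>\<close>.
\<close>

lemma schwartz_affine:
  assumes "\<phi> \<in> schwartz" and "s \<noteq> 0"
  shows "(\<lambda>x. c * \<phi> (t + s * x)) \<in> schwartz"
proof -
  have "vderiv n (\<lambda>x. c * \<phi> (t + s * x)) differentiable (at x)" for n x
  proof -
    have "vderiv n \<phi> differentiable (at (t + s * x))"
      using assms unfolding schwartz_def by blast
    then have "(vderiv n \<phi> \<circ> (\<lambda>x. t + s * x)) differentiable (at x)"
      by (intro differentiable_chain_at) auto
    then show ?thesis
      by (auto simp: vderiv_affine[OF assms(1)] o_def intro!: differentiable_mult)
  qed
  moreover have "bounded (range (\<lambda>x. of_real (x ^ m) * vderiv n (\<lambda>x. c * \<phi> (t + s * x)) x))" for m n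
  proof -
    obtain B0 where B0: "\<And>x. norm (of_real (x ^ 0) * vderiv n \<phi> x) \<le> B0"
      using schwartz_vderiv_bound[OF assms(1)] by blast
    obtain B1 where B1: "\<And>x. norm (of_real (x ^ m) * vderiv n \<phi> x) \<le> B1"
      using schwartz_vderiv_bound[OF assms(1)] by blast
    \<comment> \<open>chosen so that \<open>\<bar>x\<bar> \<le> K * max 1 \<bar>t + s * x\<bar>\<close>\<close>
    define K where "K = (1 + \<bar>t\<bar>) / \<bar>s\<bar>"
    have K: "0 \<le> K" by (simp add: K_def)
    have "norm (of_real (x ^ m) * vderiv n (\<lambda>x. c * \<phi> (t + s * x)) x)
        \<le> norm c * \<bar>s ^ n\<bar> * (K ^ m * (B0 + B1))" for x
    proof -
      define y where "y = t + s * x"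
      have "x = (y - t) / s" using assms(2) by (simp add: y_def)
      then have "\<bar>x\<bar> \<le> (\<bar>y\<bar> + \<bar>t\<bar>) / \<bar>s\<bar>"
        by (simp add: divide_right_mono)
      also have "\<bar>y\<bar> + \<bar>t\<bar> \<le> (1 + \<bar>t\<bar>) * max 1 \<bar>y\<bar>"
      proof -
        have "\<bar>t\<bar> * 1 \<le> \<bar>t\<bar> * max 1 \<bar>y\<bar>" by (intro mult_left_mono) auto
        moreover have "\<bar>y\<bar> \<le> max 1 \<bar>y\<bar>" by simp
        ultimately show ?thesis unfolding distrib_right by linarith
      qed
      then have "(\<bar>y\<bar> + \<bar>t\<bar>) / \<bar>s\<bar> \<le> K * max 1 \<bar>y\<bar>"
        using divide_right_mono[of _ _ "\<bar>s\<bar>"] by (fastforce simp: K_def)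
      finally have "\<bar>x\<bar> ^ m \<le> (K * max 1 \<bar>y\<bar>) ^ m"
        by (intro power_mono) auto
      also have "\<dots> = K ^ m * (max 1 \<bar>y\<bar>) ^ m" by (simp add: power_mult_distrib)
      also have "\<dots> \<le> K ^ m * (1 + \<bar>y\<bar> ^ m)"
        using K by (intro mult_left_mono) (auto simp: max_def)
      finally have "\<bar>x\<bar> ^ m * norm (vderiv n \<phi> y) \<le> K ^ m * (1 + \<bar>y\<bar> ^ m) * norm (vderiv n \<phi> y)"
        by (intro mult_right_mono) auto
      also have "\<dots> = K ^ m * (norm (vderiv n \<phi> y) + \<bar>y\<bar> ^ m * norm (vderiv n \<phi> y))"
        by (simp add: algebra_simps)
      also have "\<dots> \<le> K ^ m * (B0 + B1)"
        using B0[of y] B1[of y] K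
        by (intro mult_left_mono add_mono) (auto simp: norm_mult norm_power)
      finally have "norm c * \<bar>s ^ n\<bar> * (\<bar>x\<bar> ^ m * norm (vderiv n \<phi> y))
          \<le> norm c * \<bar>s ^ n\<bar> * (K ^ m * (B0 + B1))"
        by (intro mult_left_mono) auto
      then show ?thesis
        unfolding vderiv_affine[OF assms(1)] y_def norm_mult norm_of_real power_abs
        by (simp only: mult_ac)
    qed
    then show ?thesis by (auto simp: bounded_iff)
  qed
  ultimately show ?thesis by (simp add: schwartz_def)
qed

section \<open>Moments\<close>

text \<open>
  Bounds on \<open>x\<^sup>n \<phi>\<close> and \<open>x\<^sup>n\<^sup>+\<^sup>2 \<phi>\<close> together dominate \<open>x\<^sup>n \<phi>\<close> by a multiple of \<open>1 / (1 + x\<^sup>2)\<close>.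
\<close>

lemma schwartz_moment_integrable:
  assumes "\<phi> \<in> schwartz"
  shows "integrable lborel (\<lambda>x. of_real (x ^ n) * \<phi> x)"
proof -
  obtain B0 where B0: "\<And>x. norm (of_real (x ^ n) * \<phi> x) \<le> B0"
    using schwartz_bound[OF assms] by blast
  obtain B2 where B2: "\<And>x. norm (of_real (x ^ (n + 2)) * \<phi> x) \<le> B2"
    using schwartz_bound[OF assms] by blast
  have [measurable]: "\<phi> \<in> borel_measurable borel" by (rule schwartz_measurable[OF assms])
  have "integrable lborel (\<lambda>x::real. inverse (1 + x\<^sup>2))"
    using integrable_inverse_1_plus_square by (simp add: set_integrable_def)
  then have "integrable lborel (\<lambda>x. (B0 + B2) * inverse (1 + x\<^sup>2))"
    by (rule integrable_mult_right)
  then show ?thesis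
  proof (rule Bochner_Integration.integrable_bound)
    show "AE x in lborel. norm (of_real (x ^ n) * \<phi> x) \<le> norm ((B0 + B2) * inverse (1 + x\<^sup>2))"
    proof (rule AE_I2)
      fix x :: real
      have pos: "0 < 1 + x\<^sup>2" by (simp add: add_pos_nonneg)
      have "norm (of_real (x ^ n) * \<phi> x) * (1 + x\<^sup>2) \<le> B0 + B2"
      proof -
        have "norm (of_real (x ^ n) * \<phi> x) * x\<^sup>2 = norm (of_real (x ^ (n + 2)) * \<phi> x)"
          by (simp add: norm_mult norm_power power_add power2_eq_square)
        then show ?thesis using B0[of x] B2[of x] by (simp only: distrib_left)
      qed
      then have "norm (of_real (x ^ n) * \<phi> x) \<le> (B0 + B2) * inverse (1 + x\<^sup>2)"
        using pos by (simp add: field_simps)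
      then show "norm (of_real (x ^ n) * \<phi> x) \<le> norm ((B0 + B2) * inverse (1 + x\<^sup>2))"
        by simp
    qed
  qed simp
qed

lemma schwartz_integrable:
  assumes "\<phi> \<in> schwartz"
  shows "integrable lborel \<phi>"
  using schwartz_moment_integrable[OF assms, of 0] by simp

text \<open>
  Up to the factor \<open>-i\<close>, the transform of \<open>x g(x)\<close> is the derivative of the transform of \<open>g\<close>.
  By dominated convergence the difference quotients along a null sequence converge to it, and they
  are eventually zero.
\<close>

lemma fourier_vanishes_imp_fourier_times_x_vanishes:
  assumes [measurable]: "g \<in> borel_measurable borel"
    and int1: "integrable lborel (\<lambda>x. of_real x * g x)"
    and U: "open U" "\<And>\<omega>. \<omega> \<in> U \<Longrightarrow> fourier g \<omega> = 0"
    and int0: "integrable lborel g"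
    and w: "\<omega> \<in> U"
  shows "fourier (\<lambda>x. of_real x * g x) \<omega> = 0"
proof -
  define h where "h k = inverse (real (Suc k))" for k
  have h: "h \<longlonglongrightarrow> 0" unfolding h_def by (rule LIMSEQ_inverse_real_of_nat)
  have h0: "h k > 0" for k by (simp add: h_def)
  define e where "e t = exp (- \<i> * complex_of_real t)" for t
  have e_add: "e (s + t) = e s * e t" for s t
    by (simp add: e_def exp_add[symmetric] algebra_simps)
  have e_norm: "norm (e t) = 1" for t by (simp add: e_def)
  have [measurable]: "e \<in> borel_measurable borel"
    unfolding e_def by (intro borel_measurable_continuous_onI continuous_intros)
  have e_bound: "norm (e t - 1) \<le> \<bar>t\<bar>" for t
    using iexp_approx1[of "-t" 0] by (simp add: e_def)
  have e_int: "integrable lborel (\<lambda>x. e (c * x) * g x)" for c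
    by (rule Bochner_Integration.integrable_bound[OF int0]) (auto simp: norm_mult e_norm)
  \<comment> \<open>the integrand of the difference quotient of \<open>fourier g\<close> at \<open>\<omega>\<close> with increment \<open>h k\<close>\<close>
  define q where "q k x = e (\<omega> * x) * ((e (h k * x) - 1) / of_real (h k)) * g x" for k x
  have q_lim: "(\<lambda>k. integral\<^sup>L lborel (q k)) \<longlonglongrightarrow>
      integral\<^sup>L lborel (\<lambda>x. e (\<omega> * x) * (- \<i> * of_real x) * g x)"
  proof (rule integral_dominated_convergence[where w = "\<lambda>x. norm (of_real x * g x)"])
    show "integrable lborel (\<lambda>x. norm (of_real x * g x))" using int1 by (rule integrable_norm)
    show "AE x in lborel. norm (q k x) \<le> norm (of_real x * g x)" for k
    proof (rule AE_I2)
      fix x :: real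
      have "norm ((e (h k * x) - 1) / of_real (h k)) \<le> \<bar>x\<bar>"
        using e_bound[of "h k * x"] h0[of k]
        by (simp add: norm_divide field_simps abs_mult)
      then show "norm (q k x) \<le> norm (of_real x * g x)"
        unfolding q_def norm_mult e_norm norm_of_real by (auto intro!: mult_right_mono)
    qed
    show "AE x in lborel. (\<lambda>k. q k x) \<longlonglongrightarrow> e (\<omega> * x) * (- \<i> * of_real x) * g x"
    proof (rule AE_I2)
      fix x :: real
      have "((\<lambda>z. exp (- \<i> * of_real x * z)) has_field_derivative - \<i> * of_real x) (at 0)"
        by (auto intro!: derivative_eq_intros)
      then have "((\<lambda>z. (exp (- \<i> * of_real x * (0 + z)) - exp (- \<i> * of_real x * 0)) / z)
          \<longlongrightarrow> - \<i> * of_real x) (at 0)"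
        unfolding DERIV_def .
      moreover have "filterlim (\<lambda>k. complex_of_real (h k)) (at 0) sequentially"
        using tendsto_of_real[OF h, where 'a = complex] h0
        by (auto simp: filterlim_at less_imp_neq[THEN not_sym])
      ultimately have "(\<lambda>k. (exp (- \<i> * of_real x * (0 + of_real (h k))) - exp (- \<i> * of_real x * 0))
          / of_real (h k)) \<longlonglongrightarrow> - \<i> * of_real x"
        by (rule filterlim_compose)
      then have "(\<lambda>k. (e (h k * x) - 1) / of_real (h k)) \<longlonglongrightarrow> - \<i> * of_real x"
        by (simp add: e_def mult_ac)
      then show "(\<lambda>k. q k x) \<longlonglongrightarrow> e (\<omega> * x) * (- \<i> * of_real x) * g x"
        unfolding q_def by (intro tendsto_mult tendsto_const)
    qed
  qed (auto simp: q_def[abs_def])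
  have q_eq: "integral\<^sup>L lborel (q k) = (fourier g (\<omega> + h k) - fourier g \<omega>) / of_real (h k)" for k
  proof -
    have "q k = (\<lambda>x. (e ((\<omega> + h k) * x) * g x - e (\<omega> * x) * g x) / of_real (h k))"
      using h0[of k] by (intro ext) (simp add: q_def e_add distrib_right field_simps)
    then have "integral\<^sup>L lborel (q k) =
        (LINT x|lborel. (e ((\<omega> + h k) * x) * g x - e (\<omega> * x) * g x)) / of_real (h k)"
      by (simp only: integral_divide_zero)
    also have "\<dots> = (fourier g (\<omega> + h k) - fourier g \<omega>) / of_real (h k)"
      by (subst Bochner_Integration.integral_diff[OF e_int e_int]) (simp add: fourier_def e_def)
    finally show ?thesis .
  qed
  have "(\<lambda>k. \<omega> + h k) \<longlonglongrightarrow> \<omega> + 0" by (intro tendsto_add tendsto_const h)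
  then have "eventually (\<lambda>k. \<omega> + h k \<in> U) sequentially"
    using U(1) w by (auto simp: tendsto_def)
  then have "eventually (\<lambda>k. integral\<^sup>L lborel (q k) = 0) sequentially"
    by eventually_elim (simp add: q_eq U(2) w)
  then have "(\<lambda>k. integral\<^sup>L lborel (q k)) \<longlonglongrightarrow> 0"
    by (rule tendsto_eventually)
  with q_lim have "integral\<^sup>L lborel (\<lambda>x. e (\<omega> * x) * (- \<i> * of_real x) * g x) = 0"
    by (rule LIMSEQ_unique)
  also have "(\<lambda>x. e (\<omega> * x) * (- \<i> * of_real x) * g x) = (\<lambda>x. - \<i> * (e (\<omega> * x) * (of_real x * g x)))"
    by (auto simp: mult_ac)
  finally show ?thesis by (simp add: fourier_def e_def)
qed

text \<open>
  Induction on the order shows that the transforms of all \<open>x\<^sup>n \<phi>\<close> vanish on \<open>U\<close>.  The neighbourhood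
  is what keeps the induction going; the moments are the values at 0.
\<close>

lemma schwartz0_if_fourier_vanishes_near_0:
  assumes \<phi>: "\<phi> \<in> schwartz" and U: "open U" "0 \<in> U" "\<And>\<omega>. \<omega> \<in> U \<Longrightarrow> fourier \<phi> \<omega> = 0"
  shows "\<phi> \<in> schwartz0"
proof -
  have [measurable]: "\<phi> \<in> borel_measurable borel" by (rule schwartz_measurable[OF \<phi>])
  have F: "fourier (\<lambda>x. of_real (x ^ n) * \<phi> x) \<omega> = 0" if "\<omega> \<in> U" for n \<omega>
    using that
  proof (induction n arbitrary: \<omega>)
    case 0
    then show ?case using U by simp
  next
    case (Suc n)
    have "fourier (\<lambda>x. of_real x * (of_real (x ^ n) * \<phi> x)) \<omega> = 0"
    proof (rule fourier_vanishes_imp_fourier_times_x_vanishes[OF _ _ U(1) Suc.IH])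
      show "integrable lborel (\<lambda>x. of_real x * (of_real (x ^ n) * \<phi> x))"
        using schwartz_moment_integrable[OF \<phi>, of "Suc n"] by (simp add: mult_ac)
    qed (use Suc.prems schwartz_moment_integrable[OF \<phi>] in auto)
    then show ?case by (simp add: mult_ac)
  qed
  have "(LINT x|lborel. of_real (x ^ n) * \<phi> x) = 0" for n
    using F[OF U(2), of n] by (simp add: fourier_def)
  then show ?thesis using \<phi> by (simp add: schwartz0_def)
qed

section \<open>Fourier inversion\<close>

lemma gaussian_fourier:
  "(LINT u|lborel. exp (\<i> * of_real (t * u)) * of_real (std_normal_density u)) = of_real (exp (- t\<^sup>2 / 2))"
proof -
  have "char std_normal_distribution t =
      (LINT u|lborel. std_normal_density u *\<^sub>R exp (\<i> * of_real (t * u)))"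
    unfolding char_def by (subst integral_density) (auto simp: normal_density_nonneg)
  then show ?thesis
    by (simp add: char_std_normal_distribution scaleR_conv_of_real mult_ac)
qed

lemma std_normal_density_integral: "(LINT u|lborel. std_normal_density u) = 1"
  using integral_std_normal_moment_even[of 0] by simp

lemma std_normal_density_integrable: "integrable lborel std_normal_density"
  using integrable_std_normal_moment[of 0] by simp

text \<open>
  The double integral behind Fourier inversion is not absolutely convergent.  A Gaussian factor in
  the frequency makes it so; after exchanging the integrals, the frequency integral is again a
  Gaussian, and what remains is the average of \<open>\<phi>\<close> over a normal distribution centred at \<open>x\<close> with
  standard deviation \<open>s\<close>.
\<close>

lemma gaussian_regularized_inversion:
  assumes int: "integrable lborel \<phi>" and s: "s > 0"
  shows "(LINT \<omega>|lborel. exp (- \<i> * of_real (x * \<omega>)) * inv_fourier \<phi> \<omega> * of_real (exp (- (s * \<omega>)\<^sup>2 / 2)))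
       = (LINT v|lborel. of_real (std_normal_density v) * \<phi> (x + s * v))"
proof -
  have [measurable]: "\<phi> \<in> borel_measurable borel" using borel_measurable_integrable[OF int] by simp
  define G where "G \<omega> = complex_of_real (std_normal_density (s * \<omega>))" for \<omega>
  have [measurable]: "G \<in> borel_measurable borel" unfolding G_def by measurable
  define H where "H \<omega> y = G \<omega> * exp (\<i> * of_real ((y - x) * \<omega>)) * \<phi> y" for \<omega> y
  have [measurable]: "case_prod H \<in> borel_measurable (lborel \<Otimes>\<^sub>M lborel)"
    unfolding H_def by measurable
  have G_int: "integrable lborel G"
    unfolding G_def
    using lborel_integrable_real_affine[OF std_normal_density_integrable, of s 0] s
    by (intro integrable_of_real) simp
  \<comment> \<open>\<open>G\<close> is the regularizing factor, up to a constant that makes it a normal density, so that the characteristic function applies\<close>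
  have gauss: "complex_of_real (exp (- (s * \<omega>)\<^sup>2 / 2)) = sqrt (2 * pi) * G \<omega>" for \<omega>
    by (simp add: G_def std_normal_density_def)
  have H_norm: "norm (H \<omega> y) = norm (G \<omega>) * norm (\<phi> y)" for \<omega> y
    by (simp add: H_def norm_mult)
  have H_int: "integrable (lborel \<Otimes>\<^sub>M lborel) (case_prod H)"
  proof (rule lborel_pair.Fubini_integrable)
    show "integrable lborel (\<lambda>\<omega>. LINT y|lborel. norm (case_prod H (\<omega>, y)))"
      using G_int by (simp add: H_norm)
    have "integrable lborel (H \<omega>)" for \<omega>
    proof (rule Bochner_Integration.integrable_bound)
      show "integrable lborel (\<lambda>y. G \<omega> * \<phi> y)" using int by (intro integrable_mult_right)
    qed (auto simp: H_norm norm_mult H_def)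
    then show "AE \<omega> in lborel. integrable lborel (\<lambda>y. case_prod H (\<omega>, y))" by simp
  qed simp
  have inner: "(LINT \<omega>|lborel. H \<omega> y) =
      of_real (1 / s) * of_real (exp (- ((y - x) / s)\<^sup>2 / 2)) * \<phi> y" for y
  proof -
    have "(LINT \<omega>|lborel. G \<omega> * exp (\<i> * of_real ((y - x) * \<omega>))) =
        \<bar>1 / s\<bar> *\<^sub>R (LINT u|lborel. G (0 + 1 / s * u) * exp (\<i> * of_real ((y - x) * (0 + 1 / s * u))))"
      using s by (intro lborel_integral_real_affine) auto
    also have "(LINT u|lborel. G (0 + 1 / s * u) * exp (\<i> * of_real ((y - x) * (0 + 1 / s * u)))) =
        (LINT u|lborel. exp (\<i> * of_real ((y - x) / s * u)) * of_real (std_normal_density u))"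
      using s by (intro Bochner_Integration.integral_cong) (auto simp: G_def)
    also have "\<dots> = of_real (exp (- ((y - x) / s)\<^sup>2 / 2))" by (rule gaussian_fourier)
    finally show ?thesis using s by (simp add: H_def scaleR_conv_of_real)
  qed
  have "(LINT \<omega>|lborel. exp (- \<i> * of_real (x * \<omega>)) * inv_fourier \<phi> \<omega> * of_real (exp (- (s * \<omega>)\<^sup>2 / 2)))
      = (LINT \<omega>|lborel. of_real (sqrt (2 * pi) / (2 * pi)) * (LINT y|lborel. H \<omega> y))"
  proof (rule Bochner_Integration.integral_cong[OF refl])
    fix \<omega>
    have "(LINT y|lborel. H \<omega> y) =
        (LINT y|lborel. G \<omega> * exp (- \<i> * of_real (x * \<omega>)) * (exp (\<i> * of_real (y * \<omega>)) * \<phi> y))"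
      by (intro Bochner_Integration.integral_cong)
        (simp_all add: H_def left_diff_distrib right_diff_distrib exp_diff exp_minus field_simps)
    also have "\<dots> = G \<omega> * exp (- \<i> * of_real (x * \<omega>)) * (LINT y|lborel. exp (\<i> * of_real (y * \<omega>)) * \<phi> y)"
      by simp
    finally show "exp (- \<i> * of_real (x * \<omega>)) * inv_fourier \<phi> \<omega> * of_real (exp (- (s * \<omega>)\<^sup>2 / 2)) =
        of_real (sqrt (2 * pi) / (2 * pi)) * (LINT y|lborel. H \<omega> y)"
      unfolding gauss inv_fourier_def by simp
  qed
  also have "\<dots> = of_real (sqrt (2 * pi) / (2 * pi)) * (LINT y|lborel. LINT \<omega>|lborel. H \<omega> y)"
    by (simp add: lborel_pair.Fubini_integral[OF H_int])
  also have "\<dots> = (LINT y|lborel. of_real (1 / s) * (of_real (std_normal_density ((y - x) / s)) * \<phi> y))"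
  proof -
    have "sqrt (2 * pi) / (2 * pi) = 1 / sqrt (2 * pi)"
      by (simp add: sqrt_divide_self_eq inverse_eq_divide)
    then show ?thesis unfolding inner
      by (simp add: std_normal_density_def mult_ac flip: integral_mult_right_zero)
  qed
  also have "\<dots> = \<bar>s\<bar> *\<^sub>R (LINT v|lborel. of_real (1 / s) *
      (of_real (std_normal_density ((x + s * v - x) / s)) * \<phi> (x + s * v)))"
    using s by (intro lborel_integral_real_affine) auto
  also have "\<dots> = (LINT v|lborel. of_real (std_normal_density v) * \<phi> (x + s * v))"
    using s by (simp add: scaleR_conv_of_real)
  finally show ?thesis .
qed

text \<open>
  Let the width of the regularization tend to 0.  Integrability of the transform removes the Gaussian
  factor on the frequency side; on the other side the averages of the bounded continuous function
  \<open>\<phi>\<close> concentrate at \<open>x\<close>.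
\<close>

theorem fourier_inv_fourier:
  assumes int: "integrable lborel \<phi>" and cont: "\<And>x. isCont \<phi> x"
    and bound: "\<And>x. norm (\<phi> x) \<le> B" and int': "integrable lborel (inv_fourier \<phi>)"
  shows "fourier (inv_fourier \<phi>) = \<phi>"
proof
  fix x
  define h where "h k = inverse (real (Suc k))" for k
  have h: "h \<longlonglongrightarrow> 0" unfolding h_def by (rule LIMSEQ_inverse_real_of_nat)
  have h0: "h k > 0" for k by (simp add: h_def)
  have [measurable]: "\<phi> \<in> borel_measurable borel" using borel_measurable_integrable[OF int] by simp
  have [measurable]: "inv_fourier \<phi> \<in> borel_measurable borel"
    using borel_measurable_integrable[OF int'] by simp
  let ?A = "\<lambda>k. LINT \<omega>|lborel. exp (- \<i> * of_real (x * \<omega>)) * inv_fourier \<phi> \<omega> *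
      of_real (exp (- (h k * \<omega>)\<^sup>2 / 2))"
  have "?A \<longlonglongrightarrow> (LINT \<omega>|lborel. exp (- \<i> * of_real (x * \<omega>)) * inv_fourier \<phi> \<omega> * 1)"
  proof (rule integral_dominated_convergence[where w = "\<lambda>\<omega>. norm (inv_fourier \<phi> \<omega>)"])
    show "AE \<omega> in lborel. (\<lambda>k. exp (- \<i> * of_real (x * \<omega>)) * inv_fourier \<phi> \<omega> *
        of_real (exp (- (h k * \<omega>)\<^sup>2 / 2))) \<longlonglongrightarrow> exp (- \<i> * of_real (x * \<omega>)) * inv_fourier \<phi> \<omega> * 1"
    proof (intro AE_I2 tendsto_mult tendsto_const)
      fix \<omega>
      have "(\<lambda>k. complex_of_real (exp (- (h k * \<omega>)\<^sup>2 / 2))) \<longlonglongrightarrow> of_real (exp (- (0 * \<omega>)\<^sup>2 / 2))"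
        by (intro tendsto_intros h) auto
      then show "(\<lambda>k. complex_of_real (exp (- (h k * \<omega>)\<^sup>2 / 2))) \<longlonglongrightarrow> 1" by simp
    qed
    show "AE \<omega> in lborel. norm (exp (- \<i> * of_real (x * \<omega>)) * inv_fourier \<phi> \<omega> *
        of_real (exp (- (h k * \<omega>)\<^sup>2 / 2))) \<le> norm (inv_fourier \<phi> \<omega>)" for k
      by (auto simp: norm_mult intro!: mult_left_le)
  qed (use integrable_norm[OF int'] in auto)
  then have A: "?A \<longlonglongrightarrow> fourier (inv_fourier \<phi>) x" by (simp add: fourier_def)
  have "(\<lambda>k. LINT v|lborel. of_real (std_normal_density v) * \<phi> (x + h k * v)) \<longlonglongrightarrow>
      (LINT v|lborel. of_real (std_normal_density v) * \<phi> x)"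
  proof (rule integral_dominated_convergence[where w = "\<lambda>v. std_normal_density v * B"])
    show "integrable lborel (\<lambda>v. std_normal_density v * B)"
      using std_normal_density_integrable by simp
    show "AE v in lborel. (\<lambda>k. of_real (std_normal_density v) * \<phi> (x + h k * v)) \<longlonglongrightarrow>
        of_real (std_normal_density v) * \<phi> x"
    proof (intro AE_I2 tendsto_mult tendsto_const)
      fix v
      have "(\<lambda>k. x + h k * v) \<longlonglongrightarrow> x + 0 * v" by (intro tendsto_intros h)
      then show "(\<lambda>k. \<phi> (x + h k * v)) \<longlonglongrightarrow> \<phi> x"
        using isCont_tendsto_compose[OF cont] by fastforce
    qed
    show "AE v in lborel. norm (of_real (std_normal_density v) * \<phi> (x + h k * v)) \<le>
        std_normal_density v * B" for k
      using bound by (auto simp: norm_mult normal_density_nonneg intro!: mult_left_mono)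
  qed auto
  then have "?A \<longlonglongrightarrow> (LINT v|lborel. of_real (std_normal_density v) * \<phi> x)"
    unfolding gaussian_regularized_inversion[OF int h0] .
  also have "(LINT v|lborel. of_real (std_normal_density v) * \<phi> x) = \<phi> x"
    by (simp add: std_normal_density_integral)
  finally show "fourier (inv_fourier \<phi>) x = \<phi> x" using A LIMSEQ_unique by blast
qed

lemma inv_fourier_eq_fourier_reflect: "inv_fourier \<phi> \<omega> = fourier \<phi> (- \<omega>) / of_real (2 * pi)"
  by (simp add: inv_fourier_def fourier_def mult_ac)

lemma norm_fourier_le: "norm (fourier \<phi> \<omega>) \<le> (LINT x|lborel. norm (\<phi> x))"
proof -
  have "norm (fourier \<phi> \<omega>) \<le> (LINT x|lborel. norm (exp (- \<i> * of_real (\<omega> * x)) * \<phi> x))"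
    unfolding fourier_def by (rule integral_norm_bound)
  then show ?thesis by (simp add: norm_mult)
qed

lemma fourier_measurable:
  assumes [measurable]: "\<phi> \<in> borel_measurable borel"
  shows "fourier \<phi> \<in> borel_measurable borel"
proof -
  have "(\<lambda>\<omega>. LINT x|lborel. exp (- \<i> * of_real (\<omega> * x)) * \<phi> x) \<in> borel_measurable borel"
    by measurable
  then show ?thesis by (simp add: fourier_def[abs_def])
qed

text \<open>
  A transform is bounded, hence integrable once it vanishes outside a bounded interval; so the
  inversion theorem applies.
\<close>

lemma fourier_inv_fourier_band_limited:
  assumes \<phi>: "\<phi> \<in> schwartz" and supp: "\<And>\<omega>. \<omega> \<notin> {c..d} \<Longrightarrow> fourier \<phi> \<omega> = 0"
  shows "fourier (inv_fourier \<phi>) = \<phi>"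
proof -
  obtain B where B: "\<And>x. norm (of_real (x ^ 0) * \<phi> x) \<le> B"
    using schwartz_bound[OF \<phi>] by blast
  have [measurable]: "fourier \<phi> \<in> borel_measurable borel"
    by (intro fourier_measurable schwartz_measurable \<phi>)
  have "integrable lborel (inv_fourier \<phi>)"
  proof (rule Bochner_Integration.integrable_bound)
    let ?M = "(LINT x|lborel. norm (\<phi> x)) / (2 * pi)"
    show "integrable lborel (\<lambda>\<omega>::real. ?M * indicat_real {- d..- c} \<omega>)"
      by (intro integrable_mult_right integrable_real_indicator) (auto simp: emeasure_lborel_Icc_eq)
    show "AE \<omega> in lborel. norm (inv_fourier \<phi> \<omega>) \<le> norm (?M * indicat_real {- d..- c} \<omega>)"
      using norm_fourier_le[of \<phi>] supp
      by (auto simp: inv_fourier_eq_fourier_reflect norm_divide indicator_def divide_right_mono)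
  qed (simp add: inv_fourier_eq_fourier_reflect[abs_def])
  then show ?thesis
    using fourier_inv_fourier[OF schwartz_integrable[OF \<phi>] schwartz_continuous[OF \<phi>], of B] B
    by simp
qed

section \<open>The fractional Hilbert transform on one-sided spectra\<close>

text \<open>
  The phase is \<open>+\<alpha> \<pi>/2\<close>, although the symbol has phase \<open>-\<alpha> \<pi>/2\<close> on positive frequencies: the
  bilinear pairing moves the symbol onto the inverse transform of \<open>\<phi>\<close>, which sits on the negative
  ones.
\<close>

lemma frac_hilbert_positive_spectrum:
  assumes f: "f \<in> tempered_mod_poly" and \<phi>: "\<phi> \<in> schwartz" and c: "0 < c"
    and supp: "\<And>\<omega>. \<omega> \<notin> {c..d} \<Longrightarrow> fourier \<phi> \<omega> = 0"
  shows "frac_hilbert \<alpha> f \<phi> = exp (\<i> * of_real (\<alpha> * (pi / 2))) * f \<phi>"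
proof -
  let ?c = "exp (\<i> * of_real (\<alpha> * (pi / 2)))"
  \<comment> \<open>for \<open>\<omega> \<ge> 0\<close> both sides vanish, whatever the symbol\<close>
  have "exp (- \<i> * of_real (\<alpha> * (pi / 2) * sgn \<omega>)) * inv_fourier \<phi> \<omega> = ?c * inv_fourier \<phi> \<omega>" for \<omega>
    using supp[of "- \<omega>"] c
    by (cases "\<omega> < 0") (auto simp: inv_fourier_eq_fourier_reflect)
  then have "frac_hilbert \<alpha> f \<phi> = f (fourier (\<lambda>\<omega>. ?c * inv_fourier \<phi> \<omega>))"
    unfolding frac_hilbert_def dist_inv_fourier_def dist_mult_def dist_fourier_def by presburger
  also have "fourier (\<lambda>\<omega>. ?c * inv_fourier \<phi> \<omega>) = (\<lambda>x. ?c * fourier (inv_fourier \<phi>) x)"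
    unfolding fourier_def mult.left_commute[of _ ?c] integral_mult_right_zero ..
  also have "fourier (inv_fourier \<phi>) = \<phi>"
    by (rule fourier_inv_fourier_band_limited[OF \<phi> supp])
  also have "f (\<lambda>x. ?c * \<phi> x) = ?c * f \<phi>"
  proof -
    have "\<phi> \<in> schwartz0"
      by (rule schwartz0_if_fourier_vanishes_near_0[OF \<phi>, of "{..<c}"]) (use supp c in auto)
    then show ?thesis using f unfolding tempered_mod_poly_def schwartz_dual_def by blast
  qed
  finally show ?thesis .
qed

lemma wavelet_affine: "wavelet \<kappa> a b = (\<lambda>x. of_real (1 / sqrt a) * \<kappa> (- b / a + 1 / a * x))"
  by (simp add: wavelet_def diff_divide_distrib)

lemma fourier_wavelet:
  assumes a: "0 < a"
  shows "fourier (wavelet \<kappa> a b) \<omega> =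
    of_real (sqrt a) * exp (- \<i> * of_real (\<omega> * b)) * fourier \<kappa> (a * \<omega>)"
proof -
  have "fourier (wavelet \<kappa> a b) \<omega> = \<bar>a\<bar> *\<^sub>R (LINT y|lborel.
      exp (- \<i> * of_real (\<omega> * (b + a * y))) * wavelet \<kappa> a b (b + a * y))"
    unfolding fourier_def using a by (intro lborel_integral_real_affine) auto
  also have "(LINT y|lborel. exp (- \<i> * of_real (\<omega> * (b + a * y))) * wavelet \<kappa> a b (b + a * y)) =
      (LINT y|lborel. of_real (1 / sqrt a) * exp (- \<i> * of_real (\<omega> * b)) *
        (exp (- \<i> * of_real (a * \<omega> * y)) * \<kappa> y))"
    using a by (intro Bochner_Integration.integral_cong)
      (simp_all add: wavelet_def distrib_left right_diff_distrib exp_diff exp_minus field_simps)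
  also have "\<dots> = of_real (1 / sqrt a) * exp (- \<i> * of_real (\<omega> * b)) * fourier \<kappa> (a * \<omega>)"
    by (simp add: fourier_def)
  also have "\<bar>a\<bar> *\<^sub>R \<dots> = of_real (a / sqrt a) * exp (- \<i> * of_real (\<omega> * b)) * fourier \<kappa> (a * \<omega>)"
    using a by (simp add: scaleR_conv_of_real)
  also have "a / sqrt a = sqrt a" using a by (simp add: real_div_sqrt)
  finally show ?thesis .
qed

lemma frac_hilbert_wavelet:
  assumes \<kappa>: "signature_wavelet \<kappa>" and f: "f \<in> tempered_mod_poly" and a: "0 < a"
  shows "frac_hilbert \<alpha> f (wavelet \<kappa> a b) =
    exp (\<i> * of_real (\<alpha> * (pi / 2))) * f (wavelet \<kappa> a b)"
proof -
  from \<kappa> obtain c d where c: "0 < c" and cd: "closure {\<omega>. fourier \<kappa> \<omega> \<noteq> 0} \<subseteq> {c..d}"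
    and S: "\<kappa> \<in> schwartz"
    by (auto simp: signature_wavelet_def)
  have supp: "fourier \<kappa> \<omega> = 0" if "\<omega> \<notin> {c..d}" for \<omega>
    using cd closure_subset[of "{\<omega>. fourier \<kappa> \<omega> \<noteq> 0}"] that by blast
  show ?thesis
  proof (rule frac_hilbert_positive_spectrum[OF f])
    show "wavelet \<kappa> a b \<in> schwartz"
      unfolding wavelet_affine using S a by (intro schwartz_affine) auto
    show "0 < c / a" using c a by simp
    show "fourier (wavelet \<kappa> a b) \<omega> = 0" if "\<omega> \<notin> {c / a..d / a}" for \<omega>
    proof -
      have "a * \<omega> \<notin> {c..d}" using that a by (auto simp: field_simps)
      then show ?thesis by (simp add: fourier_wavelet[OF a] supp)
    qed
  qed
qed

text \<open>
  Multiplication by \<open>c\<close> commutes with \<open>sgn\<close> since \<open>c\<close> has modulus 1, and it is invertible, so the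
  limits for \<open>f\<close> and \<open>g\<close> exist simultaneously; without a limit both signatures are 0.
\<close>

lemma signature_unimodular_factor:
  assumes eq: "\<And>a. 0 < a \<Longrightarrow> g (wavelet \<kappa> a b) = c * f (wavelet \<kappa> a b)" and c: "norm c = 1"
  shows "signature \<kappa> g b = c * signature \<kappa> f b"
proof -
  let ?F = "\<lambda>a. sgn (f (wavelet \<kappa> a b))" and ?G = "\<lambda>a. sgn (g (wavelet \<kappa> a b))"
  have c0: "c \<noteq> 0" using c by auto
  have "sgn c = c" using c by (simp add: sgn_div_norm)
  then have ev: "eventually (\<lambda>a. ?G a = c * ?F a) (at_right 0)"
    by (auto simp: eventually_at_filter eq sgn_mult intro!: always_eventually)
  have GF: "(?G \<longlongrightarrow> L) (at_right 0) \<longleftrightarrow> (?F \<longlongrightarrow> L / c) (at_right 0)" for L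
  proof -
    have "(?G \<longlongrightarrow> L) (at_right 0) \<longleftrightarrow> ((\<lambda>a. c * ?F a) \<longlongrightarrow> c * (L / c)) (at_right 0)"
      using tendsto_cong[OF ev] c0 by simp
    also have "\<dots> \<longleftrightarrow> (?F \<longlongrightarrow> L / c) (at_right 0)"
      using c0 by (rule tendsto_mult_left_iff)
    finally show ?thesis .
  qed
  show ?thesis
  proof (cases "\<exists>L. (?F \<longlongrightarrow> L) (at_right 0)")
    case True
    then obtain L where L: "(?F \<longlongrightarrow> L) (at_right 0)" by blast
    then have "(?G \<longlongrightarrow> c * L) (at_right 0)" using GF[of "c * L"] c0 by simp
    then show ?thesis using L
      by (auto simp: signature_def tendsto_Lim[OF trivial_limit_at_right_real])
  next
    case False
    then have "\<nexists>L. (?G \<longlongrightarrow> L) (at_right 0)" using GF by blast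
    then show ?thesis using False by (simp add: signature_def)
  qed
qed

theorem theorem5p1:
  fixes \<kappa> :: "real \<Rightarrow> complex" and f :: "(real \<Rightarrow> complex) \<Rightarrow> complex" and b \<alpha> :: real
  assumes "signature_wavelet \<kappa>"
    and "f \<in> tempered_mod_poly"
  shows "signature \<kappa> (frac_hilbert \<alpha> f) b =
           exp (\<i> * of_real (\<alpha> * (pi / 2))) * signature \<kappa> f b"
  by (intro signature_unimodular_factor frac_hilbert_wavelet assms) auto

end
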